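(* Let $0<r\le1$, $0<\alpha\le\frac12$, $0\le\rho,\delta\le1$, and $k\in\mathbb{N}$ with $k>\frac n2$. Let $a\in S^m_{\rho,\delta,0,2k}(\mathbb{T}^n\times\mathbb{Z}^n)$. Assume $w_1=\alpha n$, $1<p_1\le2$, $q_1=(\alpha+\frac1{p_1'})^{-1}$, and $0\le w_2<2k-n$, $m<-\frac nr-w_2-2k\delta$, $1\le p_2\le\infty$, $1\le q_2\le\infty$. Then the pseudo-differential operator $T_a:B^{w_1}_{p_1,q_1}(\mathbb{T}^n)\to B^{w_2}_{p_2,q_2}(\mathbb{T}^n)$ is $r$-nuclear.
   Context: Toroidal Fourier transform: $\widehat f(\xi)=\int_{\mathbb{T}^n}e^{-i2\pi x\cdot\xi}f(x)dx$, $\xi\in\mathbb{Z}^n$; $\langle\xi\rangle=(1+|\xi|^2)^{1/2}$. For $\mu\in\mathbb{N}$, $S^m_{\rho,\delta,0,\mu}(\mathbb{T}^n\times\mathbb{Z}^n)$ is the set of functions $a(x,\xi)$, smooth in $x\in\mathbb{T}^n$ for each $\xi\in\mathbb{Z}^n$, with $|\partial_x^\beta a(x,\xi)|\le C_\beta\langle\xi\rangle^{m+\delta|\beta|}$ for all $|\beta|\le\mu$. The associated operator is $T_au(x)=\sum_{\xi\in\mathbb{Z}^n}e^{i2\pi x\cdot\xi}a(x,\xi)\widehat u(\xi)$. Periodic Besov spaces: for $w\in\mathbb{R}$, $0<p\le\infty$, $0<q<\infty$, $\|f\|_{B^w_{p,q}}=\big(\sum_{m=0}^\infty2^{mwq}\|\sum_{2^m\le|\xi|<2^{m+1}}e^{i2\pi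 x\cdot\xi}\widehat f(\xi)\|^q_{L^p(\mathbb{T}^n)}\big)^{1/q}$, and $\|f\|_{B^w_{p,\infty}}=\sup_{m\in\mathbb{N}}2^{mw}\|\sum_{2^m\le|\xi|<2^{m+1}}e^{i2\pi x\cdot\xi}\widehat f(\xi)\|_{L^p(\mathbb{T}^n)}$. $p'$ is the conjugate exponent. For Banach spaces $E,F$, $T:E\to F$ is $r$-nuclear if $Tf=\sum_ne_n'(f)y_n$ with $e'_n\in E'$, $y_n\in F$, $\sum_n\|e'_n\|^r_{E'}\|y_n\|^r_F<\infty$.
   Formalization: The frequency ξ=0 is included in the m=0 dyadic block of the Besov norms (|ξ|<2 instead of 1≤|ξ|<2); as literally defined the norm vanishes on constants and the claim fails, e.g. for a(x,0)=e^{i2πx_1}, a(x,ξ)=0 otherwise. *)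

theory Defs
  imports "HOL-Analysis.Analysis" "HOL-Probability.Essential_Supremum"
begin

text \<open>Torus T^n modelled on the fundamental cube [0,1]^n in real^'n, frequencies in int^'n.\<close>

definition unit_cube :: "(real^'n) set" where
  "unit_cube = cbox 0 One"

definition xdot :: "real^'n \<Rightarrow> int^'n \<Rightarrow> real" where
  "xdot x \<xi> = (\<Sum>i\<in>UNIV. x$i * real_of_int (\<xi>$i))"

definition znorm :: "int^'n \<Rightarrow> real" where
  "znorm \<xi> = sqrt (\<Sum>i\<in>UNIV. (real_of_int (\<xi>$i))^2)"

definition jbr :: "int^'n \<Rightarrow> real" where
  "jbr \<xi> = sqrt (1 + (znorm \<xi>)^2)"

definition fourier :: "(real^'n \<Rightarrow> complex) \<Rightarrow> int^'n \<Rightarrow> complex" where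
  "fourier f \<xi> = (LINT x|lebesgue_on unit_cube. cis (- 2 * pi * xdot x \<xi>) * f x)"

definition lpnorm :: "ereal \<Rightarrow> (real^'n \<Rightarrow> complex) \<Rightarrow> real" where
  "lpnorm p g = (if p = \<infinity> then real_of_ereal (esssup (lebesgue_on unit_cube) (\<lambda>x. ereal (cmod (g x))))
     else (LINT x|lebesgue_on unit_cube. cmod (g x) powr real_of_ereal p) powr (1 / real_of_ereal p))"

definition dyad_set :: "nat \<Rightarrow> (int^'n) set" where
  "dyad_set m = {\<xi>. (m = 0 \<or> 2 ^ m \<le> znorm \<xi>) \<and> znorm \<xi> < 2 ^ (m + 1)}"

text \<open>Dyadic block of a (distribution given by its) Fourier coefficient sequence u.\<close>
definition dyad_block :: "nat \<Rightarrow> (int^'n \<Rightarrow> complex) \<Rightarrow> real^'n \<Rightarrow> complex" where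
  "dyad_block m u x = (\<Sum>\<xi>\<in>dyad_set m. cis (2 * pi * xdot x \<xi>) * u \<xi>)"

definition besov_term :: "real \<Rightarrow> ereal \<Rightarrow> (int^'n \<Rightarrow> complex) \<Rightarrow> nat \<Rightarrow> real" where
  "besov_term w p u m = 2 powr (real m * w) * lpnorm p (dyad_block m u)"

definition besov_norm :: "real \<Rightarrow> ereal \<Rightarrow> ereal \<Rightarrow> (int^'n \<Rightarrow> complex) \<Rightarrow> real" where
  "besov_norm w p q u = (if q = \<infinity> then (SUP m. besov_term w p u m)
     else (\<Sum>m. besov_term w p u m powr real_of_ereal q) powr (1 / real_of_ereal q))"

text \<open>Besov space B^w_{p,q}(T^n), as the set of Fourier coefficient sequences with finite norm.\<close>
definition besov_space :: "real \<Rightarrow> ereal \<Rightarrow> ereal \<Rightarrow> (int^'n \<Rightarrow> complex) set" where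
  "besov_space w p q = {u. (p = \<infinity> \<longrightarrow> (\<forall>m. esssup (lebesgue_on unit_cube) (\<lambda>x. ereal (cmod (dyad_block m u x))) < \<infinity>))
     \<and> (if q = \<infinity> then bdd_above (range (besov_term w p u))
        else summable (\<lambda>m. besov_term w p u m powr real_of_ereal q))}"

definition partial_dir :: "'n \<Rightarrow> (real^'n \<Rightarrow> complex) \<Rightarrow> real^'n \<Rightarrow> complex" where
  "partial_dir i f x = vector_derivative (\<lambda>t. f (x + t *\<^sub>R axis i 1)) (at 0)"

primrec pdl :: "'n list \<Rightarrow> (real^'n \<Rightarrow> complex) \<Rightarrow> real^'n \<Rightarrow> complex" where
  "pdl [] f = f"
| "pdl (i # is) f = partial_dir i (pdl is f)"

text \<open>Symbol class S^m_{\<rho>,\<delta>,0,\<mu>}(T^n \<times> Z^n) (only x-derivatives; \<rho> plays no role).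
  Smoothness in x: all iterated partial derivatives are (Frechet) differentiable.
  Derivatives of order |\<beta>| are taken along lists of |\<beta>| coordinate directions.\<close>
definition symbol_class :: "real \<Rightarrow> real \<Rightarrow> real \<Rightarrow> nat \<Rightarrow> (real^'n \<Rightarrow> int^'n \<Rightarrow> complex) set" where
  "symbol_class m \<rho> \<delta> \<mu> = {a.
     (\<forall>\<xi>. (\<forall>x i. a (x + axis i 1) \<xi> = a x \<xi>)
        \<and> (\<forall>is x. pdl is (\<lambda>y. a y \<xi>) differentiable (at x)))
   \<and> (\<forall>is. length is \<le> \<mu> \<longrightarrow>
        (\<exists>C. \<forall>x \<xi>. cmod (pdl is (\<lambda>y. a y \<xi>) x) \<le> C * jbr \<xi> powr (m + \<delta> * real (length is))))}"

definition pdo :: "(real^'n \<Rightarrow> int^'n \<Rightarrow> complex) \<Rightarrow> (int^'n \<Rightarrow> complex) \<Rightarrow> real^'n \<Rightarrow> complex" where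
  "pdo a u x = (\<Sum>\<^sub>\<infinity>\<xi>. cis (2 * pi * xdot x \<xi>) * a x \<xi> * u \<xi>)"

definition bounded_functional :: "(int^'n \<Rightarrow> complex) set \<Rightarrow> ((int^'n \<Rightarrow> complex) \<Rightarrow> real)
    \<Rightarrow> ((int^'n \<Rightarrow> complex) \<Rightarrow> complex) \<Rightarrow> bool" where
  "bounded_functional E nE e \<longleftrightarrow>
     (\<forall>u\<in>E. \<forall>v\<in>E. e (\<lambda>\<xi>. u \<xi> + v \<xi>) = e u + e v)
   \<and> (\<forall>u\<in>E. \<forall>c. e (\<lambda>\<xi>. c * u \<xi>) = c * e u)
   \<and> (\<exists>C. \<forall>u\<in>E. cmod (e u) \<le> C * nE u)"

definition dual_norm :: "(int^'n \<Rightarrow> complex) set \<Rightarrow> ((int^'n \<Rightarrow> complex) \<Rightarrow> real)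
    \<Rightarrow> ((int^'n \<Rightarrow> complex) \<Rightarrow> complex) \<Rightarrow> real" where
  "dual_norm E nE e = (SUP u\<in>{u\<in>E. nE u \<le> 1}. cmod (e u))"

definition r_nuclear :: "real \<Rightarrow> (int^'n \<Rightarrow> complex) set \<Rightarrow> ((int^'n \<Rightarrow> complex) \<Rightarrow> real)
    \<Rightarrow> (int^'n \<Rightarrow> complex) set \<Rightarrow> ((int^'n \<Rightarrow> complex) \<Rightarrow> real)
    \<Rightarrow> ((int^'n \<Rightarrow> complex) \<Rightarrow> (int^'n \<Rightarrow> complex)) \<Rightarrow> bool" where
  "r_nuclear r E nE F nF T \<longleftrightarrow>
     (\<forall>u\<in>E. T u \<in> F) \<and>
     (\<exists>e y. (\<forall>j::nat. bounded_functional E nE (e j)) \<and> (\<forall>j. y j \<in> F)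
        \<and> summable (\<lambda>j. (dual_norm E nE (e j) * nF (y j)) powr r)
        \<and> (\<forall>u\<in>E. (\<lambda>N. nF (\<lambda>\<xi>. T u \<xi> - (\<Sum>j<N. e j u * y j \<xi>))) \<longlonglongrightarrow> 0))"

end

theory Submission
  imports Defs "HOL-Probability.Probability_Measure"
begin

text \<open>The expansion \<open>T\<^sub>a u = \<Sum>\<^sub>\<xi> u(\<xi>) e\<^sub>\<xi> a(\<cdot>, \<xi>)\<close> over the Fourier coefficients of \<open>u\<close> is itself
  the nuclear decomposition. The coefficient functional \<open>u \<mapsto> u(\<xi>)\<close> has norm at most 1, because
  a Fourier coefficient is bounded by the \<open>L\<^sup>p\<close> norm of the dyadic block that contains it.
  Integrating by parts \<open>2k\<close> times bounds the Fourier transform of \<open>a(\<cdot>, \<xi>)\<close> at \<open>\<zeta>\<close> by a multiple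
  of \<open>\<langle>\<zeta>\<rangle>\<^bsup>-2k\<^esup> \<langle>\<xi>\<rangle>\<^bsup>m+2k\<delta>\<^esup>\<close>. With \<open>w = w\<^sub>2\<close>, the target norm of \<open>v\<close> is at most
  \<open>\<Sum>\<^sub>\<eta> \<langle>\<eta>\<rangle>\<^bsup>w\<^esup> |v(\<eta>)|\<close>, so Peetre's inequality and \<open>w - 2k < -n\<close> give a norm of order
  \<open>\<langle>\<xi>\<rangle>\<^bsup>m+2k\<delta>+w\<^esup>\<close> for \<open>e\<^sub>\<xi> a(\<cdot>, \<xi>)\<close>; its \<open>r\<close>-th power is summable over the lattice by the
  assumption on \<open>m\<close>.\<close>

section \<open>Integrals of periodic functions over the unit cube\<close>

lemma One_vec_nth [simp]: "(One :: real^'n) $ i = 1"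
  by (simp add: cart_eq_inner_axis)

text \<open>The cube, stretched by \<open>t\<close> in direction \<open>i\<close>, is cut once at
  height 1 and once at height \<open>t\<close>. The slab above the first cut is the slab below the
  second one moved by a full period, so both carry the same integral. What remains is the cube on
  one side and the translated cube on the other.\<close>

lemma integral_unit_cube_shift:
  fixes h :: "real^'n \<Rightarrow> complex"
  assumes cont: "continuous_on UNIV h" and per: "\<And>x. h (x + axis i 1) = h x"
    and t: "0 \<le> t" "t \<le> 1"
  shows "integral unit_cube (\<lambda>x. h (x + t *\<^sub>R axis i 1)) = integral unit_cube h"
proof -
  let ?e = "axis i 1 :: real^'n"
  have int: "h integrable_on cbox u v" for u v
    by (rule integrable_continuous) (rule continuous_on_subset[OF cont], simp)
  have eB: "?e \<in> Basis" by (simp add: axis_in_Basis_iff)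
  have box: "x \<in> cbox (c *\<^sub>R ?e) (One + d *\<^sub>R ?e) \<longleftrightarrow>
      c \<le> x $ i \<and> x $ i \<le> 1 + d \<and> (\<forall>j. j \<noteq> i \<longrightarrow> 0 \<le> x $ j \<and> x $ j \<le> 1)" for c d x
  proof -
    have *: "(\<forall>j. Q j) \<longleftrightarrow> Q i \<and> (\<forall>j. j \<noteq> i \<longrightarrow> Q j)" for Q by metis
    show ?thesis unfolding mem_box_cart vector_add_component One_vec_nth
      by (subst *) (simp add: axis_def conj_assoc)
  qed
  let ?W = "cbox 0 (One + t *\<^sub>R ?e)" and ?P = "cbox 0 (One + (t - 1) *\<^sub>R ?e)"
  have cube: "?W \<inter> {x. x \<bullet> ?e \<le> 1} = cbox 0 One"
    using t box[of _ 0 t] box[of _ 0 0] by (auto simp: inner_axis)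
  have P: "?W \<inter> {x. x \<bullet> ?e \<le> t} = ?P"
    using t box[of _ 0 t] box[of _ 0 "t - 1"] by (auto simp: inner_axis)
  have S: "?W \<inter> {x. x \<bullet> ?e \<ge> t} = cbox (0 + t *\<^sub>R ?e) (One + t *\<^sub>R ?e)"
    using t box[of _ 0 t] box[of _ t t] by (auto simp: inner_axis)
  have P': "?W \<inter> {x. x \<bullet> ?e \<ge> 1} = cbox (0 + ?e) (One + (t - 1) *\<^sub>R ?e + ?e)"
    using t box[of _ 0 t] box[of _ 1 t] by (auto simp: inner_axis algebra_simps)
  have "integral (cbox 0 One) h + integral (cbox (0 + ?e) (One + (t - 1) *\<^sub>R ?e + ?e)) h
      = integral ?P h + integral (cbox (0 + t *\<^sub>R ?e) (One + t *\<^sub>R ?e)) h"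
    using integral_split[OF int eB, of 0 "One + t *\<^sub>R ?e" 1]
      integral_split[OF int eB, of 0 "One + t *\<^sub>R ?e" t]
    by (simp only: cube P S P')
  moreover have "integral (cbox (0 + ?e) (One + (t - 1) *\<^sub>R ?e + ?e)) h = integral ?P h"
    using per by (simp only: integral_shift_cbox_plus[symmetric] o_def add.commute[of ?e])
  moreover have "integral (cbox (0 + t *\<^sub>R ?e) (One + t *\<^sub>R ?e)) h
      = integral (cbox 0 One) (\<lambda>x. h (x + t *\<^sub>R ?e))"
    by (simp only: integral_shift_cbox_plus[symmetric] o_def add.commute[of "t *\<^sub>R ?e"])
  ultimately show ?thesis by (simp add: unit_cube_def)
qed

text \<open>The derivative in \<open>partial_dir\<close> is taken at parameter 0; composing with
  \<open>\<lambda>s. s - t\<close> carries it to any other parameter on the same line.\<close>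

lemma has_vector_derivative_partial_dir:
  assumes "f differentiable (at (x + t *\<^sub>R axis i 1))"
  shows "((\<lambda>t. f (x + t *\<^sub>R axis i 1)) has_vector_derivative partial_dir i f (x + t *\<^sub>R axis i 1))
    (at t within S)"
proof -
  let ?g = "\<lambda>s. f ((x + t *\<^sub>R axis i 1) + s *\<^sub>R axis i 1)"
  have "?g differentiable (at 0)"
    by (rule differentiable_compose[where f = f]) (use assms in \<open>auto intro!: derivative_intros\<close>)
  then have "(?g has_vector_derivative partial_dir i f (x + t *\<^sub>R axis i 1)) (at 0)"
    unfolding partial_dir_def by (simp add: vector_derivative_works)
  moreover have "((\<lambda>s. s - t) has_vector_derivative 1) (at t)"
    by (auto intro!: derivative_eq_intros)
  ultimately have "(?g \<circ> (\<lambda>s. s - t) has_vector_derivative partial_dir i f (x + t *\<^sub>R axis i 1)) (at t)"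
    using vector_diff_chain_at[of "\<lambda>s. s - t" 1 t ?g] by simp
  then show ?thesis
    by (auto simp: o_def algebra_simps intro: has_vector_derivative_at_within)
qed

text \<open>The integral over the cube is invariant under translation of a periodic function, so its
  derivative in the direction of the translation vanishes.\<close>

lemma integral_partial_dir_eq_0:
  fixes h :: "real^'n \<Rightarrow> complex"
  assumes diff: "\<And>x. h differentiable (at x)" and per: "\<And>x. h (x + axis i 1) = h x"
    and cont: "continuous_on UNIV (partial_dir i h)"
  shows "integral unit_cube (partial_dir i h) = 0"
proof -
  let ?e = "axis i 1 :: real^'n"
  let ?I = "\<lambda>t. integral (cbox 0 One) (\<lambda>x. h (x + t *\<^sub>R ?e))"
  have ch: "continuous_on UNIV h"
    using diff by (simp add: differentiable_imp_continuous_on differentiable_on_def)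
  have ch': "continuous_on S (\<lambda>x. h (x + t *\<^sub>R ?e))" for S t
    by (rule continuous_on_compose2[OF ch]) (auto intro!: continuous_intros)
  have "(?I has_vector_derivative integral (cbox 0 One) (\<lambda>x. partial_dir i h (x + 0 *\<^sub>R ?e)))
      (at 0 within {0..1})"
  proof (rule leibniz_rule_vector_derivative)
    show "continuous_on ({0..1} \<times> cbox 0 One) (\<lambda>(t, x). partial_dir i h (x + t *\<^sub>R ?e))"
      unfolding split_beta
      by (rule continuous_on_compose2[OF cont]) (auto intro!: continuous_intros)
  qed (auto intro!: has_vector_derivative_partial_dir diff integrable_continuous ch')
  \<comment> \<open>The translation formula covers \<open>t\<close> in [0,1] only, so both
    derivatives at 0 are one-sided. They agree because 0 is a limit point of the interval.\<close>
  moreover have "(?I has_vector_derivative 0) (at 0 within {0..1})"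
  proof (rule has_vector_derivative_transform[where f = "\<lambda>_. integral unit_cube h"])
    show "?I t = integral unit_cube h" if "t \<in> {0..1}" for t
      using integral_unit_cube_shift[OF ch, of i t] per that by (simp add: unit_cube_def)
  qed auto
  moreover have "at 0 within {0..1::real} \<noteq> bot"
    by (simp add: at_within_Icc_at_right)
  ultimately show ?thesis
    using vector_derivative_unique_within[of 0 "{0..1}" ?I "integral (cbox 0 One) (partial_dir i h)" 0]
    by (simp add: unit_cube_def)
qed

section \<open>Integration by parts for Fourier coefficients\<close>

lemma xdot_add_left: "xdot (x + y) \<xi> = xdot x \<xi> + xdot y \<xi>"
  and xdot_diff_right: "xdot x (\<xi> - \<eta>) = xdot x \<xi> - xdot x \<eta>"
  by (simp_all add: xdot_def algebra_simps sum.distrib sum_subtractf)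

lemma xdot_0_right [simp]: "xdot x 0 = 0"
  by (simp add: xdot_def)

lemma xdot_scaleR_axis [simp]: "xdot (t *\<^sub>R axis i 1) \<xi> = t * real_of_int (\<xi> $ i)"
  by (simp add: xdot_def axis_def if_distrib[of "\<lambda>x. _ * x"] if_distrib[of "\<lambda>x. x * _"] cong: if_cong)

lemma xdot_axis [simp]: "xdot (axis i 1) \<xi> = real_of_int (\<xi> $ i)"
  using xdot_scaleR_axis[of 1 i \<xi>] by simp

lemma differentiable_cis_xdot: "(\<lambda>x. cis (c * xdot x \<xi>)) differentiable (at x)"
  unfolding xdot_def differentiable_def
  by (rule exI, rule has_derivative_cis)
     (auto intro!: derivative_eq_intros bounded_linear_imp_has_derivative bounded_linear_vec_nth)

lemma continuous_on_cis_xdot [continuous_intros]: "continuous_on S (\<lambda>x. cis (c * xdot x \<xi>))"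
  unfolding xdot_def cis_conv_exp by (intro continuous_intros)

lemma integrable_unit_cube:
  fixes f :: "real^'n \<Rightarrow> 'b::euclidean_space"
  assumes "continuous_on UNIV f"
  shows "integrable (lebesgue_on unit_cube) f"
  unfolding unit_cube_def
  by (rule continuous_imp_integrable) (rule continuous_on_subset[OF assms], simp)

lemma lebesgue_integral_unit_cube:
  fixes f :: "real^'n \<Rightarrow> 'b::euclidean_space"
  assumes "continuous_on UNIV f"
  shows "(LINT x|lebesgue_on unit_cube. f x) = integral unit_cube f"
  by (rule lebesgue_integral_eq_integral[OF integrable_unit_cube[OF assms]]) (simp add: unit_cube_def)

text \<open>The product \<open>h\<close> of \<open>f\<close> with the character is again periodic,
  because \<open>\<zeta> $ i\<close> is an integer. Its derivative therefore has integral 0, and the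
  product rule splits that integral into the two sides of the claim.\<close>

lemma fourier_partial_dir:
  fixes f :: "real^'n \<Rightarrow> complex"
  assumes diff: "\<And>x. f differentiable (at x)" and per: "\<And>x. f (x + axis i 1) = f x"
    and cont: "continuous_on UNIV (partial_dir i f)"
  shows "fourier (partial_dir i f) \<zeta> = 2 * pi * \<i> * of_int (\<zeta> $ i) * fourier f \<zeta>"
proof -
  let ?c = "\<lambda>x. cis (- 2 * pi * xdot x \<zeta>)"
  define h where "h x = ?c x * f x" for x
  have cf: "continuous_on UNIV f"
    using diff by (simp add: differentiable_imp_continuous_on differentiable_on_def)
  have pd: "partial_dir i h x = ?c x * partial_dir i f x - 2 * pi * \<i> * of_int (\<zeta> $ i) * (?c x * f x)" for x
  proof -
    have f: "((\<lambda>t. f (x + t *\<^sub>R axis i 1)) has_vector_derivative partial_dir i f x) (at 0)"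
      using has_vector_derivative_partial_dir[of f x 0 i UNIV] diff by simp
    have c: "((\<lambda>t. ?c (x + t *\<^sub>R axis i 1)) has_vector_derivative
        (- 2 * pi * \<i> * of_int (\<zeta> $ i) * ?c x)) (at 0)"
      unfolding xdot_add_left xdot_scaleR_axis has_vector_derivative_def
      by (auto intro!: derivative_eq_intros simp: fun_eq_iff scaleR_conv_of_real algebra_simps)
    have "((\<lambda>t. h (x + t *\<^sub>R axis i 1)) has_vector_derivative
        ?c x * partial_dir i f x + (- 2 * pi * \<i> * of_int (\<zeta> $ i) * ?c x) * f x) (at 0)"
      unfolding h_def using has_vector_derivative_mult[OF c f] by simp
    then show ?thesis
      unfolding partial_dir_def[of i h] by (subst vector_derivative_at) (simp_all add: mult.assoc)
  qed
  have 1: "continuous_on UNIV (\<lambda>x. ?c x * partial_dir i f x)" and 2: "continuous_on UNIV (\<lambda>x. ?c x * f x)"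
    using continuous_on_cis_xdot[of UNIV "- 2 * pi" \<zeta>] by (auto intro!: continuous_intros cont cf)
  have ch': "continuous_on UNIV (partial_dir i h)"
    by (subst ext[of "partial_dir i h", OF pd]) (rule continuous_on_diff[OF 1 continuous_on_mult_left[OF 2]])
  have "integral unit_cube (partial_dir i h) = 0"
  proof (rule integral_partial_dir_eq_0)
    show "h differentiable (at x)" for x
      using differentiable_cis_xdot[of "- 2 * pi" \<zeta> x] diff unfolding h_def by (intro differentiable_mult) auto
    show "h (x + axis i 1) = h x" for x
    proof -
      have "- 2 * pi * xdot (x + axis i 1) \<zeta> = - 2 * pi * xdot x \<zeta> + 2 * pi * (- real_of_int (\<zeta> $ i))"
        by (simp add: xdot_add_left algebra_simps)
      then have "?c (x + axis i 1) = ?c x * cis (2 * pi * (- real_of_int (\<zeta> $ i)))"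
        by (simp only: cis_mult)
      then show ?thesis
        by (simp add: h_def per cis_multiple_2pi[of "- real_of_int (\<zeta> $ i)", simplified])
    qed
    show "continuous_on UNIV (partial_dir i h)" by (rule ch')
  qed
  then have "(LINT x|lebesgue_on unit_cube. partial_dir i h x) = 0"
    by (simp only: lebesgue_integral_unit_cube[OF ch'])
  moreover have "(LINT x|lebesgue_on unit_cube. ?c x * partial_dir i f x - 2 * pi * \<i> * of_int (\<zeta> $ i) * (?c x * f x))
      = fourier (partial_dir i f) \<zeta> - 2 * pi * \<i> * of_int (\<zeta> $ i) * fourier f \<zeta>"
    unfolding fourier_def
    by (simp only: Bochner_Integration.integral_diff[OF integrable_unit_cube[OF 1]
        integrable_mult_right[OF integrable_unit_cube[OF 2]]] integral_mult_right_zero)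
  ultimately show ?thesis by (simp only: pd) simp
qed

lemma pdl_axis_periodic:
  assumes "\<And>x. f (x + axis i 1) = f x"
  shows "pdl is f (x + axis i 1) = pdl is f x"
proof (induction "is" arbitrary: x)
  case (Cons j "is")
  have "pdl is f (x + axis i 1 + t *\<^sub>R axis j 1) = pdl is f (x + t *\<^sub>R axis j 1)" for t
    using Cons[of "x + t *\<^sub>R axis j 1"] by (simp add: algebra_simps)
  then show ?case by (simp add: partial_dir_def)
qed (simp add: assms)

lemma fourier_pdl_replicate:
  fixes f :: "real^'n \<Rightarrow> complex"
  assumes diff: "\<And>is x. pdl is f differentiable (at x)" and per: "\<And>x. f (x + axis i 1) = f x"
  shows "fourier (pdl (replicate j i) f) \<zeta> = (2 * pi * \<i> * of_int (\<zeta> $ i)) ^ j * fourier f \<zeta>"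
proof (induction j)
  case (Suc j)
  have "continuous_on UNIV (pdl (i # replicate j i) f)"
    using diff by (simp add: differentiable_imp_continuous_on differentiable_on_def del: pdl.simps)
  then have "fourier (partial_dir i (pdl (replicate j i) f)) \<zeta>
      = 2 * pi * \<i> * of_int (\<zeta> $ i) * fourier (pdl (replicate j i) f) \<zeta>"
    using diff by (intro fourier_partial_dir pdl_axis_periodic) (auto intro: per)
  with Suc show ?case by simp
qed simp

text \<open>Total mass 1 is what lets the comparisons between sup bounds, Fourier coefficients and
  Lp norms hold with constant 1.\<close>

lemma prob_space_unit_cube: "prob_space (lebesgue_on unit_cube)"
  by (rule prob_spaceI) (simp add: unit_cube_def emeasure_restrict_space space_restrict_space)

lemma norm_fourier_le:
  fixes f :: "real^'n \<Rightarrow> complex"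
  assumes "continuous_on UNIV f" "\<And>x. cmod (f x) \<le> C"
  shows "cmod (fourier f \<zeta>) \<le> C"
proof -
  let ?c = "\<lambda>x. cis (- 2 * pi * xdot x \<zeta>)"
  interpret prob_space "lebesgue_on (unit_cube :: (real^'n) set)" by (rule prob_space_unit_cube)
  have "continuous_on UNIV (\<lambda>x. ?c x * f x)"
    using continuous_on_cis_xdot[of UNIV "- 2 * pi" \<zeta>] by (auto intro!: continuous_intros assms)
  then have int: "integrable (lebesgue_on unit_cube) (\<lambda>x. ?c x * f x)"
    by (rule integrable_unit_cube)
  have "cmod (fourier f \<zeta>) \<le> (LINT x|lebesgue_on unit_cube. cmod (?c x * f x))"
    unfolding fourier_def by (rule integral_norm_bound)
  also have "\<dots> \<le> (LINT x|lebesgue_on (unit_cube :: (real^'n) set). C)"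
    by (intro Bochner_Integration.integral_mono integrable_norm int) (auto simp: norm_mult assms)
  finally show ?thesis using prob_space by simp
qed

section \<open>Decay of Fourier coefficients\<close>

lemma jbr_ge_1: "jbr \<xi> \<ge> 1"
  by (simp add: jbr_def)

lemma znorm_power2: "(znorm \<xi>)\<^sup>2 = (\<Sum>i\<in>UNIV. (real_of_int (\<xi> $ i))\<^sup>2)"
  by (simp add: znorm_def sum_nonneg)

lemma jbr_power2: "(jbr \<xi>)\<^sup>2 = 1 + (\<Sum>i\<in>UNIV. (real_of_int (\<xi> $ i))\<^sup>2)"
  by (simp add: jbr_def znorm_power2 sum_nonneg)

text \<open>Reduces the bracket to pure powers of single coordinates, which are what repeated
  derivatives in one direction produce on the Fourier side. If \<open>b\<close> is the largest
  modulus of a coordinate, the squared bracket is at most \<open>1 + CARD('n)\<close> times the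
  maximum of 1 and the square of \<open>b\<close>.\<close>

lemma jbr_power_even_le:
  fixes \<xi> :: "int^'n"
  shows "jbr \<xi> ^ (2 * k) \<le> (1 + real CARD('n)) ^ k * (1 + (\<Sum>i\<in>UNIV. \<bar>real_of_int (\<xi> $ i)\<bar> ^ (2 * k)))"
proof -
  obtain i0 where i0: "\<bar>real_of_int (\<xi> $ i)\<bar> \<le> \<bar>real_of_int (\<xi> $ i0)\<bar>" for i
  proof -
    let ?R = "range (\<lambda>i. \<bar>real_of_int (\<xi> $ i)\<bar>)"
    have "Max ?R \<in> ?R" by (rule Max_in) auto
    then obtain i0 where i0: "Max ?R = \<bar>real_of_int (\<xi> $ i0)\<bar>" by blast
    have "\<bar>real_of_int (\<xi> $ i)\<bar> \<le> \<bar>real_of_int (\<xi> $ i0)\<bar>" for i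
      unfolding i0[symmetric] by (rule Max_ge) auto
    then show ?thesis by (rule that)
  qed
  define b where "b = \<bar>real_of_int (\<xi> $ i0)\<bar>"
  have "(jbr \<xi>)\<^sup>2 \<le> 1 + (\<Sum>i\<in>(UNIV::'n set). b\<^sup>2)"
    unfolding jbr_power2 b_def using i0 by (intro add_left_mono sum_mono) (simp add: abs_le_square_iff)
  also have "\<dots> = 1 + real CARD('n) * b\<^sup>2" by simp
  also have "\<dots> \<le> 1 * max 1 (b\<^sup>2) + real CARD('n) * max 1 (b\<^sup>2)"
    by (intro add_mono mult_left_mono) auto
  also have "\<dots> = (1 + real CARD('n)) * max 1 (b\<^sup>2)" by (simp only: ring_distribs)
  finally have "((jbr \<xi>)\<^sup>2) ^ k \<le> ((1 + real CARD('n)) * max 1 (b\<^sup>2)) ^ k"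
    by (rule power_mono) simp
  also have "\<dots> = (1 + real CARD('n)) ^ k * max 1 (b\<^sup>2) ^ k"
    by (rule power_mult_distrib)
  also have "max 1 (b\<^sup>2) ^ k \<le> 1 + b ^ (2 * k)"
    by (simp add: max_def power_mult b_def)
  also have "b ^ (2 * k) \<le> (\<Sum>i\<in>UNIV. \<bar>real_of_int (\<xi> $ i)\<bar> ^ (2 * k))"
    unfolding b_def by (rule member_le_sum) auto
  finally show ?thesis by (simp add: power_mult)
qed

text \<open>Integrating by parts \<open>2 * k\<close> times in direction \<open>i\<close> costs a
  factor of modulus at least the \<open>2 * k\<close>-th power of
  \<open>\<bar>\<zeta> $ i\<bar>\<close>, since 2 pi is at least 1. Adding these bounds over all
  directions to the one without derivatives gives \<open>1 + CARD('n)\<close> times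
  \<open>B\<close>; the other \<open>k\<close> factors come from the bracket.\<close>

lemma fourier_decay:
  fixes f :: "real^'n \<Rightarrow> complex"
  assumes diff: "\<And>is x. pdl is f differentiable (at x)" and per: "\<And>x i. f (x + axis i 1) = f x"
    and bound0: "\<And>x. cmod (f x) \<le> B" and bound: "\<And>x i. cmod (pdl (replicate (2 * k) i) f x) \<le> B"
  shows "jbr \<zeta> ^ (2 * k) * cmod (fourier f \<zeta>) \<le> (1 + real CARD('n)) ^ (k + 1) * B"
proof -
  have cont: "continuous_on UNIV (pdl is f)" for "is"
    using diff by (simp add: differentiable_imp_continuous_on differentiable_on_def)
  have i: "\<bar>real_of_int (\<zeta> $ i)\<bar> ^ (2 * k) * cmod (fourier f \<zeta>) \<le> B" for i
  proof -
    have "(2 * pi * \<bar>real_of_int (\<zeta> $ i)\<bar>) ^ (2 * k) * cmod (fourier f \<zeta>)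
      = cmod (fourier (pdl (replicate (2 * k) i) f) \<zeta>)"
      using fourier_pdl_replicate[of f i "2 * k" \<zeta>] diff per by (simp add: norm_mult norm_power)
    also have "\<dots> \<le> B" by (rule norm_fourier_le[OF cont bound])
    finally have *: "(2 * pi * \<bar>real_of_int (\<zeta> $ i)\<bar>) ^ (2 * k) * cmod (fourier f \<zeta>) \<le> B" .
    have "1 * \<bar>real_of_int (\<zeta> $ i)\<bar> \<le> 2 * pi * \<bar>real_of_int (\<zeta> $ i)\<bar>"
      using pi_ge_two by (intro mult_right_mono) auto
    then have "\<bar>real_of_int (\<zeta> $ i)\<bar> ^ (2 * k) \<le> (2 * pi * \<bar>real_of_int (\<zeta> $ i)\<bar>) ^ (2 * k)"
      by (intro power_mono) auto
    then show ?thesis using * by (meson mult_right_mono norm_ge_zero order.trans)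
  qed
  have "jbr \<zeta> ^ (2 * k) * cmod (fourier f \<zeta>)
    \<le> (1 + real CARD('n)) ^ k * ((1 + (\<Sum>i\<in>UNIV. \<bar>real_of_int (\<zeta> $ i)\<bar> ^ (2 * k))) * cmod (fourier f \<zeta>))"
    using mult_right_mono[OF jbr_power_even_le[of \<zeta> k] norm_ge_zero] by (simp add: mult.assoc)
  also have "(1 + (\<Sum>i\<in>UNIV. \<bar>real_of_int (\<zeta> $ i)\<bar> ^ (2 * k))) * cmod (fourier f \<zeta>)
    = cmod (fourier f \<zeta>) + (\<Sum>i\<in>UNIV. \<bar>real_of_int (\<zeta> $ i)\<bar> ^ (2 * k) * cmod (fourier f \<zeta>))"
    by (simp add: ring_distribs sum_distrib_right)
  also have "\<dots> \<le> B + (\<Sum>i\<in>(UNIV :: 'n set). B)"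
    using cont[of "[]"] by (intro add_mono sum_mono i norm_fourier_le bound0) auto
  also have "\<dots> = (1 + real CARD('n)) * B" by (simp add: ring_distribs)
  finally show ?thesis by (simp add: mult_left_mono mult.assoc mult.left_commute)
qed

section \<open>Modulation and orthonormality of the characters\<close>

text \<open>Used twice: with \<open>f\<close> constant it reduces orthonormality of the characters
  to \<open>fourier_1\<close>, and with \<open>f\<close> a symbol at fixed frequency it gives the
  coefficients of the vectors in the nuclear decomposition.\<close>

lemma fourier_cis_mult:
  "fourier (\<lambda>x. cis (2 * pi * xdot x \<xi>) * f x) \<eta> = fourier f (\<eta> - \<xi>)"
proof -
  have "cis (- 2 * pi * xdot x \<eta>) * (cis (2 * pi * xdot x \<xi>) * f x) = cis (- 2 * pi * xdot x (\<eta> - \<xi>)) * f x" for x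
    by (simp add: xdot_diff_right cis_mult mult.assoc[symmetric] right_diff_distrib add.commute)
  then show ?thesis by (simp only: fourier_def)
qed

lemma fourier_0 [simp]: "fourier (\<lambda>x. 0) \<zeta> = 0"
  by (simp add: fourier_def)

text \<open>A constant has derivative 0, so integration by parts in a direction with
  \<open>\<zeta> $ i \<noteq> 0\<close> forces its coefficient at \<open>\<zeta>\<close> to
  vanish.\<close>

lemma fourier_1:
  fixes \<zeta> :: "int^'n"
  shows "fourier (\<lambda>x. 1) \<zeta> = (if \<zeta> = 0 then 1 else 0)"
proof (cases "\<zeta> = 0")
  case True
  interpret prob_space "lebesgue_on (unit_cube :: (real^'n) set)" by (rule prob_space_unit_cube)
  show ?thesis using prob_space by (simp add: fourier_def True)
next
  case False
  then obtain i where i: "\<zeta> $ i \<noteq> 0" by (auto simp: vec_eq_iff)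
  have pd: "partial_dir i (\<lambda>x. 1) = (\<lambda>x. 0)"
    by (simp add: partial_dir_def fun_eq_iff)
  have "fourier (partial_dir i (\<lambda>x. 1)) \<zeta> = 2 * pi * \<i> * of_int (\<zeta> $ i) * fourier (\<lambda>x. 1) \<zeta>"
    by (rule fourier_partial_dir) (simp_all add: pd)
  then show ?thesis using i False by (simp add: pd)
qed

lemma integrable_fourier:
  assumes "continuous_on UNIV f"
  shows "integrable (lebesgue_on unit_cube) (\<lambda>x. cis (- 2 * pi * xdot x \<zeta>) * f x)"
  using continuous_on_cis_xdot[of UNIV "- 2 * pi" \<zeta>]
  by (auto intro!: integrable_unit_cube continuous_intros assms)

lemma fourier_sum:
  assumes "\<And>i. i \<in> I \<Longrightarrow> continuous_on UNIV (f i)"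
  shows "fourier (\<lambda>x. \<Sum>i\<in>I. f i x) \<zeta> = (\<Sum>i\<in>I. fourier (f i) \<zeta>)"
  unfolding fourier_def sum_distrib_left
  by (rule Bochner_Integration.integral_sum) (rule integrable_fourier[OF assms])

lemma fourier_mult_right: "fourier (\<lambda>x. f x * c) \<zeta> = fourier f \<zeta> * c"
  by (simp add: fourier_def mult.assoc[symmetric])

section \<open>Dyadic sets and blocks\<close>

text \<open>Transfers finiteness and the product formula for sums from extensional function spaces
  to vectors.\<close>

lemma bij_betw_vec_lambda: "bij_betw vec_lambda (UNIV \<rightarrow>\<^sub>E B) {\<xi> :: 'a^'n. \<forall>i. \<xi> $ i \<in> B}"
  by (rule bij_betwI[where g = vec_nth]) (auto simp: PiE_def)

lemma abs_nth_le_znorm: "\<bar>real_of_int (\<xi> $ i)\<bar> \<le> znorm \<xi>"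
  unfolding znorm_def by (rule real_le_rsqrt) (auto intro: member_le_sum)

lemma finite_dyad_set: "finite (dyad_set m :: (int^'n) set)"
proof -
  have "(dyad_set m :: (int^'n) set) \<subseteq> {\<xi>. \<forall>i. \<xi> $ i \<in> {-(2 ^ (m + 1))..2 ^ (m + 1)}}"
  proof safe
    fix \<xi> :: "int^'n" and i
    assume "\<xi> \<in> dyad_set m"
    then have "\<bar>real_of_int (\<xi> $ i)\<bar> \<le> 2 ^ (m + 1)"
      using abs_nth_le_znorm[of \<xi> i] by (simp add: dyad_set_def)
    then have "\<bar>\<xi> $ i\<bar> \<le> 2 ^ (m + 1)"
      by (metis of_int_abs of_int_le_iff of_int_numeral of_int_power)
    then show "\<xi> $ i \<in> {-(2 ^ (m + 1))..2 ^ (m + 1)}" by auto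
  qed
  moreover have "finite {\<xi> :: int^'n. \<forall>i. \<xi> $ i \<in> {-(2 ^ (m + 1))..2 ^ (m + 1)}}"
    by (rule bij_betw_finite[OF bij_betw_vec_lambda, THEN iffD1]) (simp add: finite_PiE)
  ultimately show ?thesis by (rule finite_subset)
qed

lemma dyad_set_disjoint:
  assumes "m \<noteq> m'" shows "dyad_set m \<inter> dyad_set m' = {}"
proof -
  have "dyad_set i \<inter> dyad_set j = {}" if "i < j" for i j
  proof -
    have "(2::real) ^ (i + 1) \<le> 2 ^ j" using that by (intro power_increasing) auto
    then show ?thesis using that by (auto simp: dyad_set_def)
  qed
  then show ?thesis using assms by (metis inf_commute nat_neq_iff)
qed

text \<open>The least \<open>n\<close> with \<open>znorm \<xi> < 2 ^ (n + 1)\<close> is the index: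
  minimality gives the lower bound when \<open>n\<close> is positive, and \<open>dyad_set 0\<close>
  asks for none, so that it contains the origin.\<close>

lemma ex_dyad_set: "\<exists>m. \<xi> \<in> dyad_set m"
proof -
  obtain n where "znorm \<xi> < 2 ^ n" using real_arch_pow[of 2] by auto
  also have "(2::real) ^ n \<le> 2 ^ (n + 1)" by simp
  finally have ex: "\<exists>n. znorm \<xi> < 2 ^ (n + 1)" by blast
  define m where "m = (LEAST n. znorm \<xi> < 2 ^ (n + 1))"
  have "znorm \<xi> < 2 ^ (m + 1)" unfolding m_def using ex by (rule LeastI_ex)
  moreover have "2 ^ m \<le> znorm \<xi>" if "m \<noteq> 0"
  proof -
    have "m - 1 < m" using that by simp
    then have "\<not> znorm \<xi> < 2 ^ ((m - 1) + 1)" unfolding m_def by (rule not_less_Least)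
    then show ?thesis using that by simp
  qed
  ultimately show ?thesis by (auto simp: dyad_set_def)
qed

lemma continuous_on_dyad_block: "continuous_on S (dyad_block m u)"
  unfolding dyad_block_def by (intro continuous_intros)

text \<open>A block is a finite trigonometric polynomial, and orthonormality of the characters
  recovers its coefficients.\<close>

lemma fourier_dyad_block:
  assumes "\<xi> \<in> dyad_set m"
  shows "fourier (dyad_block m u) \<xi> = u \<xi>"
proof -
  have "fourier (dyad_block m u) \<xi> = (\<Sum>\<eta>\<in>dyad_set m. fourier (\<lambda>x. cis (2 * pi * xdot x \<eta>) * 1) \<xi> * u \<eta>)"
    unfolding dyad_block_def mult_1_right fourier_mult_right[symmetric]
    by (rule fourier_sum) (intro continuous_intros)
  also have "\<dots> = (\<Sum>\<eta>\<in>dyad_set m. if \<eta> = \<xi> then u \<eta> else 0)"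
    unfolding fourier_cis_mult by (intro sum.cong) (auto simp: fourier_1)
  finally show ?thesis using assms by (simp add: finite_dyad_set)
qed

section \<open>Lp norms over the unit cube\<close>

lemma integrable_norm_powr_unit_cube:
  fixes g :: "real^'n \<Rightarrow> complex"
  assumes "continuous_on UNIV g" "0 < p"
  shows "integrable (lebesgue_on unit_cube) (\<lambda>x. cmod (g x) powr p)"
  using assms by (intro integrable_unit_cube continuous_on_powr' continuous_intros) auto

lemma lpnorm_nonneg_bounded:
  fixes g :: "real^'n \<Rightarrow> complex"
  assumes cont: "continuous_on UNIV g" and bound: "\<And>x. cmod (g x) \<le> M" and p: "1 \<le> p"
  shows esssup_finite: "esssup (lebesgue_on unit_cube) (\<lambda>x. ereal (cmod (g x))) < \<infinity>"
    and lpnorm_nonneg: "0 \<le> lpnorm p g" and lpnorm_le: "lpnorm p g \<le> M"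
proof -
  let ?M = "lebesgue_on (unit_cube :: (real^'n) set)"
  interpret prob_space ?M by (rule prob_space_unit_cube)
  have M0: "0 \<le> M" using bound[of 0] norm_ge_zero order.trans by blast
  have meas: "(\<lambda>x. ereal (cmod (g x))) \<in> borel_measurable ?M"
    using borel_measurable_integrable[OF integrable_unit_cube[OF cont]] by measurable
  have le: "esssup ?M (\<lambda>x. ereal (cmod (g x))) \<le> ereal M"
    using meas by (rule esssup_I) (simp add: bound)
  then show "esssup ?M (\<lambda>x. ereal (cmod (g x))) < \<infinity>"
    using order.strict_trans1 by fastforce
  \<comment> \<open>\<open>real_of_ereal\<close> sends infinite values to 0, so the essential
    supremum is placed between 0 and \<open>M\<close> before it is converted.\<close>
  have "esssup ?M (\<lambda>x. 0) \<le> esssup ?M (\<lambda>x. ereal (cmod (g x)))"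
    by (rule esssup_AE_mono) auto
  then have ge: "0 \<le> esssup ?M (\<lambda>x. ereal (cmod (g x)))"
    using emeasure_space_1 by (subst (asm) esssup_const) auto
  have "0 \<le> lpnorm p g \<and> lpnorm p g \<le> M"
  proof (cases "p = \<infinity>")
    case True
    then show ?thesis
      using real_of_ereal_positive_mono[OF ge le] ge by (simp add: lpnorm_def real_of_ereal_pos)
  next
    case False
    with p obtain s where s: "p = ereal s" "1 \<le> s" by (cases p) auto
    have "(LINT x|?M. cmod (g x) powr s) \<le> (LINT x|?M. M powr s)"
      using s bound by (intro Bochner_Integration.integral_mono integrable_norm_powr_unit_cube cont)
        (auto intro: powr_mono2)
    then have "(LINT x|?M. cmod (g x) powr s) powr (1 / s) \<le> (M powr s) powr (1 / s)"
      using s prob_space by (intro powr_mono2) (auto intro: Bochner_Integration.integral_nonneg)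
    then show ?thesis using s M0 False by (simp add: lpnorm_def powr_powr)
  qed
  then show "0 \<le> lpnorm p g" "lpnorm p g \<le> M" by auto
qed

text \<open>Hoelder's inequality against the constant 1. For any \<open>B\<close> strictly above the
  norm, Young's inequality applied pointwise to \<open>cmod (g x) / B\<close> and 1 integrates to at
  most \<open>1 / p + (1 - 1 / p) = 1\<close>. Taking \<open>B\<close> strictly larger keeps the
  division legitimate when the norm is 0; then \<open>B\<close> tends to the norm.\<close>

lemma integral_norm_le_lpnorm:
  fixes g :: "real^'n \<Rightarrow> complex"
  assumes cont: "continuous_on UNIV g" and p: "1 < p"
  shows "(LINT x|lebesgue_on unit_cube. cmod (g x)) \<le> lpnorm (ereal p) g"
proof -
  let ?M = "lebesgue_on (unit_cube :: (real^'n) set)"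
  interpret prob_space ?M by (rule prob_space_unit_cube)
  define I where "I = (LINT x|?M. cmod (g x) powr p)"
  have I0: "0 \<le> I" unfolding I_def by (intro Bochner_Integration.integral_nonneg) auto
  have int: "integrable ?M (\<lambda>x. cmod (g x) powr p)"
    using p by (intro integrable_norm_powr_unit_cube cont) auto
  have "(LINT x|?M. cmod (g x)) \<le> B" if B: "I powr (1 / p) < B" for B
  proof -
    have B0: "0 < B" using B powr_ge_zero[of I "1 / p"] by linarith
    have IB: "I \<le> B powr p"
      using powr_mono2[of p "I powr (1 / p)" B] B p I0 by (simp add: powr_powr)
    have pt: "cmod (g x) / B \<le> cmod (g x) powr p / B powr p / p + (1 - 1 / p)" for x
    proof -
      have "cmod (g x) / B * 1 \<le> (cmod (g x) / B) powr p / p + 1 powr (p / (p - 1)) / (p / (p - 1))"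
        using p B0 by (intro Youngs_inequality) (auto simp: field_simps)
      also have "\<dots> = cmod (g x) powr p / B powr p / p + (1 - 1 / p)"
        using p B0 by (simp add: powr_divide diff_divide_distrib)
      finally show ?thesis by simp
    qed
    have "(LINT x|?M. cmod (g x) / B) \<le> (LINT x|?M. cmod (g x) powr p / B powr p / p + (1 - 1 / p))"
      using integrable_norm[OF integrable_unit_cube[OF cont]] int pt
      by (intro Bochner_Integration.integral_mono integrable_divide Bochner_Integration.integrable_add integrable_const) auto
    also have "\<dots> = I / B powr p / p + (1 - 1 / p)"
      using int prob_space by (subst Bochner_Integration.integral_add) (auto simp: I_def)
    also have "\<dots> \<le> 1 / p + (1 - 1 / p)"
      using IB B0 p by (intro add_right_mono divide_right_mono) (auto simp: divide_le_eq)
    finally show ?thesis using B0 by (simp add: divide_le_eq)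
  qed
  then have "(LINT x|?M. cmod (g x)) \<le> I powr (1 / p)"
    by (rule dense_ge)
  then show ?thesis by (simp add: lpnorm_def I_def)
qed

lemma norm_fourier_le_lpnorm:
  fixes g :: "real^'n \<Rightarrow> complex"
  assumes "continuous_on UNIV g" "1 < p"
  shows "cmod (fourier g \<xi>) \<le> lpnorm (ereal p) g"
proof -
  have "cmod (fourier g \<xi>) \<le> (LINT x|lebesgue_on unit_cube. cmod (cis (- 2 * pi * xdot x \<xi>) * g x))"
    unfolding fourier_def by (rule integral_norm_bound)
  also have "\<dots> \<le> lpnorm (ereal p) g"
    using integral_norm_le_lpnorm[OF assms] by (simp add: norm_mult)
  finally show ?thesis .
qed

section \<open>Besov norms and weighted sums of coefficients\<close>

lemma dyad_block_le: "cmod (dyad_block m v x) \<le> (\<Sum>\<eta>\<in>dyad_set m. cmod (v \<eta>))"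
  unfolding dyad_block_def by (rule order.trans[OF norm_sum]) (simp add: norm_mult)

lemma besov_term_nonneg: "1 \<le> p \<Longrightarrow> 0 \<le> besov_term w p v m"
  unfolding besov_term_def
  by (intro mult_nonneg_nonneg lpnorm_nonneg[OF continuous_on_dyad_block dyad_block_le]) auto

lemma znorm_le_jbr: "znorm \<xi> \<le> jbr \<xi>"
  by (simp add: jbr_def real_le_rsqrt)

text \<open>On the annulus of index \<open>m\<close> the bracket is at least \<open>2 ^ m\<close>,
  also for \<open>m = 0\<close> because it is never below 1. A block is bounded pointwise by the sum
  of the moduli of its coefficients, hence so is its Lp norm.\<close>

lemma besov_term_le:
  assumes "0 \<le> w" "1 \<le> p"
  shows "besov_term w p v m \<le> (\<Sum>\<eta>\<in>dyad_set m. jbr \<eta> powr w * cmod (v \<eta>))"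
proof -
  have "2 powr (real m * w) \<le> jbr \<eta> powr w" if "\<eta> \<in> dyad_set m" for \<eta>
  proof -
    have "2 ^ m \<le> jbr \<eta>"
      using that jbr_ge_1[of \<eta>] znorm_le_jbr[of \<eta>] by (auto simp: dyad_set_def)
    then have "(2 ^ m) powr w \<le> jbr \<eta> powr w" using assms by (intro powr_mono2) auto
    then show ?thesis by (simp add: powr_powr flip: powr_realpow)
  qed
  then have "2 powr (real m * w) * (\<Sum>\<eta>\<in>dyad_set m. cmod (v \<eta>)) \<le> (\<Sum>\<eta>\<in>dyad_set m. jbr \<eta> powr w * cmod (v \<eta>))"
    unfolding sum_distrib_left by (intro sum_mono mult_right_mono) auto
  moreover have "lpnorm p (dyad_block m v) \<le> (\<Sum>\<eta>\<in>dyad_set m. cmod (v \<eta>))"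
    by (rule lpnorm_le[OF continuous_on_dyad_block dyad_block_le assms(2)])
  ultimately show ?thesis
    unfolding besov_term_def by (meson mult_left_mono order.trans powr_ge_zero)
qed

text \<open>Disjointness of the annuli turns the bound on finite weighted sums into a bound
  \<open>M\<close> on the partial sums of the block terms, and the sum dominates every
  \<open>q\<close>-norm with \<open>q \<ge> 1\<close>. Stating the hypothesis for finite sets yields
  membership in the space and the norm bound at once.\<close>

lemma besov_weighted_l1:
  assumes bound: "\<And>H. finite H \<Longrightarrow> (\<Sum>\<eta>\<in>H. jbr \<eta> powr w * cmod (v \<eta>)) \<le> M"
    and w: "0 \<le> w" and p: "1 \<le> p" and q: "1 \<le> q"
  shows in_besov_space: "v \<in> besov_space w p q"
    and besov_norm_nonneg: "0 \<le> besov_norm w p q v" and besov_norm_le: "besov_norm w p q v \<le> M"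
proof -
  let ?t = "besov_term w p v"
  have t0: "0 \<le> ?t m" for m using p by (rule besov_term_nonneg)
  have sum_t: "(\<Sum>m<N. ?t m) \<le> M" for N
  proof -
    have "(\<Sum>m<N. ?t m) \<le> (\<Sum>m<N. \<Sum>\<eta>\<in>dyad_set m. jbr \<eta> powr w * cmod (v \<eta>))"
      by (intro sum_mono besov_term_le w p)
    also have "\<dots> = (\<Sum>\<eta>\<in>(\<Union>m<N. dyad_set m). jbr \<eta> powr w * cmod (v \<eta>))"
      by (rule sum.UNION_disjoint[symmetric]) (auto simp: finite_dyad_set dest: dyad_set_disjoint)
    also have "\<dots> \<le> M" by (rule bound) (auto simp: finite_dyad_set)
    finally show ?thesis .
  qed
  have tM: "?t m \<le> M" for m
    using member_le_sum[of m "{..<Suc m}" ?t] sum_t[of "Suc m"] t0 by force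
  have M0: "0 \<le> M" using bound[of "{}"] by simp
  have es: "\<forall>m. esssup (lebesgue_on unit_cube) (\<lambda>x. ereal (cmod (dyad_block m v x))) < \<infinity>"
    using esssup_finite[OF continuous_on_dyad_block dyad_block_le p] by blast
  have "v \<in> besov_space w p q \<and> 0 \<le> besov_norm w p q v \<and> besov_norm w p q v \<le> M"
  proof (cases "q = \<infinity>")
    case True
    have bdd: "bdd_above (range ?t)" using tM by (intro bdd_aboveI2)
    moreover have "0 \<le> (SUP m. ?t m)" using cSUP_upper[OF UNIV_I bdd, of 0] t0[of 0] by linarith
    moreover have "(SUP m. ?t m) \<le> M" using tM by (intro cSUP_least) auto
    ultimately show ?thesis using es True by (simp add: besov_space_def besov_norm_def)
  next
    case False
    with q obtain s where s: "q = ereal s" "1 \<le> s" by (cases q) auto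
    \<comment> \<open>The embedding of l1 into l^s: one factor is kept for summation and the
      remaining power \<open>s - 1\<close> is bounded by \<open>M\<close>.\<close>
    have le: "?t m powr s \<le> ?t m * M powr (s - 1)" for m
    proof (cases "?t m = 0")
      case False
      then have "?t m powr s = ?t m * ?t m powr (s - 1)"
        using t0[of m] by (simp add: powr_mult_base)
      also have "\<dots> \<le> ?t m * M powr (s - 1)"
        using t0 tM s by (intro mult_left_mono powr_mono2) auto
      finally show ?thesis .
    qed simp
    have part: "(\<Sum>m<N. ?t m powr s) \<le> M powr s" for N
    proof -
      have "(\<Sum>m<N. ?t m powr s) \<le> (\<Sum>m<N. ?t m) * M powr (s - 1)"
        unfolding sum_distrib_right by (intro sum_mono le)
      also have "\<dots> \<le> M * M powr (s - 1)" by (intro mult_right_mono sum_t) auto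
      also have "\<dots> = M powr s" using M0 by (cases "M = 0") (auto simp: powr_mult_base)
      finally show ?thesis .
    qed
    have summ: "summable (\<lambda>m. ?t m powr s)"
      using part by (intro summableI_nonneg_bounded) auto
    have "(\<Sum>m. ?t m powr s) \<le> M powr s" using part summ by (intro suminf_le_const) auto
    then have "(\<Sum>m. ?t m powr s) powr (1 / s) \<le> (M powr s) powr (1 / s)"
      using s summ by (intro powr_mono2 suminf_nonneg) auto
    then show ?thesis
      using es s summ M0 by (simp add: besov_space_def besov_norm_def powr_powr)
  qed
  then show "v \<in> besov_space w p q" "0 \<le> besov_norm w p q v" "besov_norm w p q v \<le> M" by auto
qed

text \<open>The single block containing \<open>\<xi>\<close> suffices: its Lp norm dominates the
  coefficient, its weight is at least 1 since \<open>w \<ge> 0\<close>, and its term is one of the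
  nonnegative terms in the norm.\<close>

lemma norm_coeff_le_besov_norm:
  assumes u: "u \<in> besov_space w (ereal p) (ereal q)" and "0 \<le> w" "1 < p" "0 < q"
  shows "cmod (u \<xi>) \<le> besov_norm w (ereal p) (ereal q) u"
proof -
  let ?t = "besov_term w (ereal p) u"
  obtain m where m: "\<xi> \<in> dyad_set m" using ex_dyad_set by blast
  have summ: "summable (\<lambda>m. ?t m powr q)" using u by (simp add: besov_space_def)
  have t0: "0 \<le> ?t m" using assms by (intro besov_term_nonneg) auto
  have lp: "cmod (u \<xi>) \<le> lpnorm (ereal p) (dyad_block m u)"
    using norm_fourier_le_lpnorm[OF continuous_on_dyad_block \<open>1 < p\<close>, of m u \<xi>] fourier_dyad_block[OF m]
    by simp
  have "1 \<le> 2 powr (real m * w)" using \<open>0 \<le> w\<close> by (intro ge_one_powr_ge_zero) auto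
  then have "1 * cmod (u \<xi>) \<le> ?t m"
    unfolding besov_term_def using lp by (intro mult_mono) auto
  also have "?t m = (?t m powr q) powr (1 / q)" using t0 \<open>0 < q\<close> by (simp add: powr_powr)
  also have "\<dots> \<le> (\<Sum>m. ?t m powr q) powr (1 / q)"
    using sum_le_suminf[OF summ, of "{m}"] \<open>0 < q\<close> by (intro powr_mono2) auto
  finally show ?thesis by (simp add: besov_norm_def)
qed

section \<open>Summability of powers of the bracket over the lattice\<close>

text \<open>The maximum with 1 makes the term at 0 equal to 1; \<open>0 powr (- t)\<close> is 0 and
  could not serve as a majorant there. The integers are covered by the natural numbers and their
  negatives.\<close>

lemma summable_on_max_abs_powr_int:
  fixes t :: real
  assumes "1 < t"
  shows "(\<lambda>k::int. max 1 \<bar>real_of_int k\<bar> powr (- t)) summable_on UNIV"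
proof -
  let ?g = "\<lambda>k::int. max 1 \<bar>real_of_int k\<bar> powr (- t)"
  have "summable (\<lambda>n. real n powr (- t))" using assms by (simp add: summable_real_powr_iff)
  moreover have ev: "\<forall>\<^sub>F n in sequentially. real n powr (- t) = max 1 (real n) powr (- t)"
    by (rule eventually_sequentiallyI[of 1]) (simp add: max_def)
  ultimately have "summable (\<lambda>n. max 1 (real n) powr (- t))"
    by (simp only: summable_cong[OF ev])
  then have N: "(\<lambda>n. max 1 (real n) powr (- t)) summable_on UNIV"
    by (simp add: summable_on_UNIV_nonneg_real_iff)
  have "?g summable_on range int"
    using N by (subst summable_on_reindex) (auto simp: o_def)
  moreover have "?g summable_on range (\<lambda>n. - int n)"
    using N by (subst summable_on_reindex) (auto simp: o_def inj_on_def)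
  moreover have "range int \<union> range (\<lambda>n. - int n) = UNIV"
  proof -
    have "k \<in> range int \<union> range (\<lambda>n. - int n)" for k
      by (cases k rule: int_cases2) auto
    then show ?thesis by blast
  qed
  ultimately show ?thesis using summable_on_union by metis
qed

text \<open>Splitting the exponent evenly, \<open>t = s / CARD('n) > 1\<close>, bounds the summand
  by a product of one-dimensional factors, since the bracket dominates 1 and every coordinate. A
  finite set of frequencies lies in the product set over all its coordinates, where the sum of
  products becomes a product of sums.\<close>

lemma summable_on_jbr_powr:
  assumes s: "real CARD('n) < s"
  shows "(\<lambda>\<xi>::int^'n. jbr \<xi> powr (- s)) summable_on UNIV"
proof (rule nonneg_bdd_above_summable_on)
  define t where "t = s / real CARD('n)"
  let ?g = "\<lambda>k::int. max 1 \<bar>real_of_int k\<bar> powr (- t)"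
  have t: "1 < t" using s by (simp add: t_def field_simps)
  have jbr_le: "jbr \<xi> powr (- s) \<le> (\<Prod>i\<in>UNIV. ?g (\<xi> $ i))" for \<xi> :: "int^'n"
  proof -
    have "jbr \<xi> powr (- s) = (jbr \<xi> powr (- t)) ^ CARD('n)"
      using jbr_ge_1[of \<xi>] by (simp add: powr_powr t_def flip: powr_realpow)
    also have "\<dots> = (\<Prod>i\<in>(UNIV::'n set). jbr \<xi> powr (- t))" by simp
    also have "\<dots> \<le> (\<Prod>i\<in>UNIV. ?g (\<xi> $ i))"
    proof (rule prod_mono)
      fix i
      have "max 1 \<bar>real_of_int (\<xi> $ i)\<bar> \<le> jbr \<xi>"
        using jbr_ge_1[of \<xi>] abs_nth_le_znorm[of \<xi> i] znorm_le_jbr[of \<xi>] by simp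
      then show "0 \<le> jbr \<xi> powr - t \<and> jbr \<xi> powr (- t) \<le> ?g (\<xi> $ i)"
        using t by (auto intro: powr_mono2')
    qed
    finally show ?thesis .
  qed
  show "bdd_above (sum (\<lambda>\<xi>::int^'n. jbr \<xi> powr (- s)) ` {F. F \<subseteq> UNIV \<and> finite F})"
  proof (rule bdd_aboveI2)
    fix F :: "(int^'n) set"
    assume "F \<in> {F. F \<subseteq> UNIV \<and> finite F}"
    then have F: "finite F" by simp
    define B where "B = (\<Union>\<xi>\<in>F. range (vec_nth \<xi>))"
    have B: "finite B" using F by (auto simp: B_def)
    have fin: "finite {\<xi> :: int^'n. \<forall>i. \<xi> $ i \<in> B}"
      by (rule bij_betw_finite[OF bij_betw_vec_lambda, THEN iffD1]) (simp add: finite_PiE B)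
    have "(\<Sum>\<xi>\<in>F. jbr \<xi> powr (- s)) \<le> (\<Sum>\<xi>\<in>F. \<Prod>i\<in>UNIV. ?g (\<xi> $ i))"
      by (intro sum_mono jbr_le)
    also have "\<dots> \<le> (\<Sum>\<xi>\<in>{\<xi> :: int^'n. \<forall>i. \<xi> $ i \<in> B}. \<Prod>i\<in>UNIV. ?g (\<xi> $ i))"
      by (rule sum_mono2[OF fin]) (auto simp: B_def intro: prod_nonneg)
    also have "\<dots> = (\<Sum>x\<in>(UNIV::'n set) \<rightarrow>\<^sub>E B. \<Prod>i\<in>UNIV. ?g (x i))"
      by (subst sum.reindex_bij_betw[OF bij_betw_vec_lambda, symmetric]) simp
    also have "\<dots> = (\<Prod>i\<in>(UNIV::'n set). \<Sum>k\<in>B. ?g k)"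
      by (rule prod_sum_PiE[symmetric]) (auto simp: B)
    also have "\<dots> \<le> (infsum ?g UNIV) ^ CARD('n)"
      using B by (auto intro!: power_mono finite_sum_le_infsum summable_on_max_abs_powr_int t sum_nonneg)
    finally show "(\<Sum>\<xi>\<in>F. jbr \<xi> powr (- s)) \<le> (infsum ?g UNIV) ^ CARD('n)" .
  qed
qed simp

section \<open>Peetre's inequality and shifted weighted sums\<close>

text \<open>Squared, it follows from \<open>znorm (\<xi> + \<zeta>)\<^sup>2 \<le> 2 * znorm
  \<xi>\<^sup>2 + 2 * znorm \<zeta>\<^sup>2\<close>; the factor 4 on the right absorbs the 2
  generously.\<close>

lemma jbr_add_le: "jbr (\<xi> + \<zeta>) \<le> 2 * jbr \<xi> * jbr \<zeta>"
proof (rule power2_le_imp_le)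
  have "real_of_int ((\<xi> + \<zeta>) $ i) ^ 2 \<le> 2 * real_of_int (\<xi> $ i) ^ 2 + 2 * real_of_int (\<zeta> $ i) ^ 2" for i
    using sum_squares_bound[of "real_of_int (\<xi> $ i)" "real_of_int (\<zeta> $ i)"] by (simp add: power2_sum)
  then have "(\<Sum>i\<in>UNIV. real_of_int ((\<xi> + \<zeta>) $ i) ^ 2)
      \<le> (\<Sum>i\<in>UNIV. 2 * real_of_int (\<xi> $ i) ^ 2 + 2 * real_of_int (\<zeta> $ i) ^ 2)"
    by (rule sum_mono)
  then have z: "(znorm (\<xi> + \<zeta>))\<^sup>2 \<le> 2 * (znorm \<xi>)\<^sup>2 + 2 * (znorm \<zeta>)\<^sup>2"
    by (simp add: znorm_power2 sum.distrib sum_distrib_left)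
  have "(jbr (\<xi> + \<zeta>))\<^sup>2 = 1 + (znorm (\<xi> + \<zeta>))\<^sup>2"
    by (simp add: jbr_power2 znorm_power2)
  also have "\<dots> \<le> 4 * ((1 + (znorm \<xi>)\<^sup>2) * (1 + (znorm \<zeta>)\<^sup>2))"
  proof -
    have "0 \<le> (znorm \<xi>)\<^sup>2 * (znorm \<zeta>)\<^sup>2" "0 \<le> (znorm \<xi>)\<^sup>2" "0 \<le> (znorm \<zeta>)\<^sup>2" by auto
    with z show ?thesis by (simp only: ring_distribs mult_1_left mult_1_right)
  qed
  also have "\<dots> = (2 * jbr \<xi> * jbr \<zeta>)\<^sup>2"
    by (simp add: power_mult_distrib jbr_power2 znorm_power2)
  finally show "(jbr (\<xi> + \<zeta>))\<^sup>2 \<le> (2 * jbr \<xi> * jbr \<zeta>)\<^sup>2" .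
  show "0 \<le> 2 * jbr \<xi> * jbr \<zeta>" using jbr_ge_1[of \<xi>] jbr_ge_1[of \<zeta>] by simp
qed

text \<open>Writing \<open>\<eta> = \<xi> + (\<eta> - \<xi>)\<close>, Peetre's inequality moves the
  weight to \<open>\<xi>\<close> at the price of a power \<open>w\<close> of the bracket of
  \<open>\<eta> - \<xi>\<close>. Decay of order \<open>s\<close> leaves the exponent
  \<open>w - s\<close>, which is summable over the lattice.\<close>

lemma weighted_sum_shift_le:
  fixes v :: "int^'n \<Rightarrow> complex"
  assumes bound: "\<And>\<zeta>. jbr \<zeta> powr s * cmod (v \<zeta>) \<le> B"
    and w: "0 \<le> w" and s: "w + real CARD('n) < s" and H: "finite H"
  shows "(\<Sum>\<eta>\<in>H. jbr \<eta> powr w * cmod (v (\<eta> - \<xi>)))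
    \<le> 2 powr w * B * (\<Sum>\<^sub>\<infinity>\<zeta>::int^'n. jbr \<zeta> powr (w - s)) * jbr \<xi> powr w"
proof -
  have jbr_pos: "0 < jbr \<zeta>" for \<zeta> :: "int^'n" using jbr_ge_1[of \<zeta>] by linarith
  have B0: "0 \<le> B" using bound[of 0] by (meson mult_nonneg_nonneg norm_ge_zero order.trans powr_ge_zero)
  have S: "(\<lambda>\<zeta>::int^'n. jbr \<zeta> powr (w - s)) summable_on UNIV"
    using summable_on_jbr_powr[where ?'n = 'n, of "s - w"] s by simp
  have pt: "jbr \<eta> powr w * cmod (v (\<eta> - \<xi>)) \<le> 2 powr w * B * jbr \<xi> powr w * jbr (\<eta> - \<xi>) powr (w - s)" for \<eta>
  proof -
    have "jbr \<eta> powr w \<le> (2 * jbr \<xi> * jbr (\<eta> - \<xi>)) powr w"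
      using jbr_add_le[of \<xi> "\<eta> - \<xi>"] jbr_pos[of \<eta>] w by (intro powr_mono2) auto
    also have "\<dots> = 2 powr w * jbr \<xi> powr w * jbr (\<eta> - \<xi>) powr w"
      using jbr_pos by (simp add: powr_mult less_imp_le)
    finally have "jbr \<eta> powr w * cmod (v (\<eta> - \<xi>))
        \<le> 2 powr w * jbr \<xi> powr w * jbr (\<eta> - \<xi>) powr w * cmod (v (\<eta> - \<xi>))"
      by (rule mult_right_mono) simp
    also have "jbr (\<eta> - \<xi>) powr w = jbr (\<eta> - \<xi>) powr (w - s) * jbr (\<eta> - \<xi>) powr s"
      by (simp flip: powr_add)
    also have "2 powr w * jbr \<xi> powr w * (jbr (\<eta> - \<xi>) powr (w - s) * jbr (\<eta> - \<xi>) powr s) * cmod (v (\<eta> - \<xi>))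
      = 2 powr w * jbr \<xi> powr w * jbr (\<eta> - \<xi>) powr (w - s) * (jbr (\<eta> - \<xi>) powr s * cmod (v (\<eta> - \<xi>)))"
      by (simp only: mult.assoc)
    also have "\<dots> \<le> 2 powr w * jbr \<xi> powr w * jbr (\<eta> - \<xi>) powr (w - s) * B"
      by (intro mult_left_mono bound) auto
    finally show ?thesis by (simp only: mult_ac)
  qed
  have "(\<Sum>\<eta>\<in>H. jbr \<eta> powr w * cmod (v (\<eta> - \<xi>)))
      \<le> 2 powr w * B * jbr \<xi> powr w * (\<Sum>\<eta>\<in>H. jbr (\<eta> - \<xi>) powr (w - s))"
    unfolding sum_distrib_left by (intro sum_mono pt)
  also have "\<dots> \<le> 2 powr w * B * jbr \<xi> powr w * (\<Sum>\<^sub>\<infinity>\<zeta>::int^'n. jbr \<zeta> powr (w - s))"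
  proof (rule mult_left_mono)
    have "(\<Sum>\<eta>\<in>H. jbr (\<eta> - \<xi>) powr (w - s)) = (\<Sum>\<zeta>\<in>(\<lambda>\<eta>. \<eta> - \<xi>) ` H. jbr \<zeta> powr (w - s))"
      by (subst sum.reindex) (auto simp: inj_on_def)
    also have "\<dots> \<le> (\<Sum>\<^sub>\<infinity>\<zeta>::int^'n. jbr \<zeta> powr (w - s))"
      using H by (intro finite_sum_le_infsum S) auto
    finally show "(\<Sum>\<eta>\<in>H. jbr (\<eta> - \<xi>) powr (w - s)) \<le> (\<Sum>\<^sub>\<infinity>\<zeta>::int^'n. jbr \<zeta> powr (w - s))" .
  qed (use B0 in auto)
  finally show ?thesis by (simp only: mult_ac)
qed

section \<open>The operator as a series over enumerated frequencies\<close>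

lemma ex_enumeration_vec: "\<exists>\<phi> :: nat \<Rightarrow> int^'n. bij \<phi>"
proof -
  have "infinite (UNIV :: (int^'n) set)" by (simp add: infinite_UNIV_vec infinite_UNIV_int)
  then show ?thesis using bij_betw_from_nat_into[of "UNIV :: (int^'n) set"] by auto
qed

lemma summable_jbr_powr_enumeration:
  fixes \<phi> :: "nat \<Rightarrow> int^'n"
  assumes "bij \<phi>" "s < - real CARD('n)"
  shows "summable (\<lambda>j. jbr (\<phi> j) powr s)"
  using summable_on_jbr_powr[where ?'n = 'n, of "- s"] summable_on_reindex_bij_betw[OF assms(1), of "\<lambda>\<xi>. jbr \<xi> powr s"] assms(2)
  by (simp add: summable_on_UNIV_nonneg_real_iff)

text \<open>The majorant \<open>A\<close> makes the series for \<open>pdo a u\<close> converge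
  absolutely and uniformly in \<open>x\<close>, so it may be integrated term by term against a
  character. Absolute convergence also identifies the unordered sum over the lattice with the series
  along \<open>\<phi>\<close>.\<close>

lemma sums_fourier_pdo:
  fixes \<phi> :: "nat \<Rightarrow> int^'n"
  assumes \<phi>: "bij \<phi>" and cont: "\<And>\<xi>. continuous_on UNIV (\<lambda>x. a x \<xi>)"
    and bound: "\<And>x \<xi>. cmod (a x \<xi>) \<le> A \<xi>" and U: "\<And>\<xi>. cmod (u \<xi>) \<le> U"
    and summ: "summable (\<lambda>j. A (\<phi> j))"
  shows "(\<lambda>j. u (\<phi> j) * fourier (\<lambda>x. a x (\<phi> j)) (\<eta> - \<phi> j)) sums fourier (pdo a u) \<eta>"
proof -
  let ?M = "lebesgue_on (unit_cube :: (real^'n) set)"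
  interpret prob_space ?M by (rule prob_space_unit_cube)
  define F where "F j x = cis (2 * pi * xdot x (\<phi> j)) * a x (\<phi> j) * u (\<phi> j)" for j x
  let ?G = "\<lambda>j x. cis (- 2 * pi * xdot x \<eta>) * F j x"
  have contF: "continuous_on UNIV (F j)" for j
    unfolding F_def by (intro continuous_intros cont)
  have F_le: "cmod (F j x) \<le> A (\<phi> j) * U" for j x
    unfolding F_def norm_mult norm_cis mult_1_left
    using U bound by (intro mult_mono) (auto intro: order.trans[OF norm_ge_zero bound])
  have summ': "summable (\<lambda>j. A (\<phi> j) * U)" using summ by (rule summable_mult2)
  have summF: "summable (\<lambda>j. norm (F j x))" for x
    by (rule summable_comparison_test'[OF summ', of 0]) (simp add: F_le)
  have pdo: "pdo a u x = (\<Sum>j. F j x)" for x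
  proof -
    have "pdo a u x = (\<Sum>\<^sub>\<infinity>j. F j x)"
      unfolding pdo_def F_def by (rule infsum_reindex_bij_betw[OF \<phi>, symmetric])
    also have "\<dots> = (\<Sum>j. F j x)"
      using norm_summable_imp_has_sum[OF summF summable_sums[OF summable_norm_cancel[OF summF]]]
      by (rule infsumI)
    finally show ?thesis .
  qed
  have int: "integrable ?M (?G j)" for j by (rule integrable_fourier[OF contF])
  have "(\<lambda>j. LINT x|?M. ?G j x) sums (LINT x|?M. (\<Sum>j. ?G j x))"
  proof (rule sums_integral[OF int])
    show "AE x in ?M. summable (\<lambda>j. norm (?G j x))"
      using summF by (simp add: norm_mult)
    have "(LINT x|?M. norm (?G j x)) \<le> A (\<phi> j) * U" for j
    proof -
      have "(LINT x|?M. norm (?G j x)) \<le> (LINT x|?M. A (\<phi> j) * U)"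
        by (intro Bochner_Integration.integral_mono integrable_norm int integrable_const)
          (simp add: norm_mult F_le)
      then show ?thesis using prob_space by simp
    qed
    then show "summable (\<lambda>j. LINT x|?M. norm (?G j x))"
      by (intro summable_comparison_test'[OF summ', of 0]) (simp add: Bochner_Integration.integral_nonneg)
  qed
  moreover have "(\<Sum>j. ?G j x) = cis (- 2 * pi * xdot x \<eta>) * pdo a u x" for x
    unfolding pdo by (rule suminf_mult[OF summable_norm_cancel[OF summF]])
  ultimately have "(\<lambda>j. fourier (F j) \<eta>) sums fourier (pdo a u) \<eta>"
    by (simp only: fourier_def)
  moreover have "fourier (F j) \<eta> = u (\<phi> j) * fourier (\<lambda>x. a x (\<phi> j)) (\<eta> - \<phi> j)" for j
    unfolding F_def fourier_mult_right fourier_cis_mult by (rule mult.commute)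
  ultimately show ?thesis by simp
qed

text \<open>For a finite piece of the tail the triangle inequality and an exchange of sums give a
  bound independent of its length \<open>J\<close>. Since \<open>H\<close> is finite, convergence at
  each \<open>\<eta>\<close> lets \<open>J\<close> tend to infinity.\<close>

lemma weighted_sum_tail_le:
  fixes y :: "nat \<Rightarrow> 'a \<Rightarrow> complex" and d :: "'a \<Rightarrow> real"
  assumes sums: "\<And>\<eta>. (\<lambda>j. c j * y j \<eta>) sums v \<eta>"
    and d: "\<And>\<eta>. 0 \<le> d \<eta>" and y: "\<And>j. (\<Sum>\<eta>\<in>H. d \<eta> * cmod (y j \<eta>)) \<le> K j"
    and summ: "summable (\<lambda>j. cmod (c j) * K j)" and H: "finite H"
  shows "(\<Sum>\<eta>\<in>H. d \<eta> * cmod (v \<eta> - (\<Sum>j<N. c j * y j \<eta>))) \<le> (\<Sum>j. cmod (c (j + N)) * K (j + N))"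
proof -
  let ?x = "\<lambda>j. \<Sum>\<eta>\<in>H. d \<eta> * cmod (c (j + N) * y (j + N) \<eta>)"
  have summN: "summable (\<lambda>j. cmod (c (j + N)) * K (j + N))"
    using summ by (rule summable_ignore_initial_segment)
  have x: "?x j \<le> cmod (c (j + N)) * K (j + N)" for j
    using mult_left_mono[OF y[of "j + N"] norm_ge_zero[of "c (j + N)"]]
    by (simp add: norm_mult sum_distrib_left mult_ac)
  have partial: "(\<Sum>\<eta>\<in>H. d \<eta> * cmod (\<Sum>j<J. c (j + N) * y (j + N) \<eta>)) \<le> (\<Sum>j. cmod (c (j + N)) * K (j + N))" for J
  proof -
    have "(\<Sum>\<eta>\<in>H. d \<eta> * cmod (\<Sum>j<J. c (j + N) * y (j + N) \<eta>))
        \<le> (\<Sum>\<eta>\<in>H. d \<eta> * (\<Sum>j<J. cmod (c (j + N) * y (j + N) \<eta>)))"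
      by (intro sum_mono mult_left_mono norm_sum d)
    also have "\<dots> = (\<Sum>j<J. ?x j)"
      unfolding sum_distrib_left by (rule sum.swap)
    also have "\<dots> \<le> (\<Sum>j<J. cmod (c (j + N)) * K (j + N))" by (intro sum_mono x)
    also have "\<dots> \<le> (\<Sum>j. cmod (c (j + N)) * K (j + N))"
    proof (rule sum_le_suminf[OF summN])
      show "0 \<le> cmod (c (j + N)) * K (j + N)" for j
        using x[of j] d by (intro order.trans[OF sum_nonneg x]) auto
    qed auto
    finally show ?thesis .
  qed
  have "(\<lambda>J. \<Sum>j<J. c (j + N) * y (j + N) \<eta>) \<longlonglongrightarrow> v \<eta> - (\<Sum>j<N. c j * y j \<eta>)" for \<eta>
    using sums_split_initial_segment[OF sums[of \<eta>], of N] by (simp add: sums_def)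
  then have "(\<lambda>J. \<Sum>\<eta>\<in>H. d \<eta> * cmod (\<Sum>j<J. c (j + N) * y (j + N) \<eta>))
      \<longlonglongrightarrow> (\<Sum>\<eta>\<in>H. d \<eta> * cmod (v \<eta> - (\<Sum>j<N. c j * y j \<eta>)))"
    by (intro tendsto_intros)
  then show ?thesis by (rule LIMSEQ_le_const2) (use partial in blast)
qed

section \<open>The nuclear decomposition\<close>

theorem theorem3p3:
  fixes a :: "real^'n \<Rightarrow> int^'n \<Rightarrow> complex"
    and r \<alpha> \<rho> \<delta> m w1 w2 p1 q1 :: real and k :: nat and p2 q2 :: ereal
  assumes "0 < r" "r \<le> 1" "0 < \<alpha>" "\<alpha> \<le> 1/2"
    and "0 \<le> \<rho>" "\<rho> \<le> 1" "0 \<le> \<delta>" "\<delta> \<le> 1"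
    and "real k > real CARD('n) / 2"
    and "a \<in> symbol_class m \<rho> \<delta> (2 * k)"
    and "w1 = \<alpha> * real CARD('n)" "1 < p1" "p1 \<le> 2"
    and "q1 = 1 / (\<alpha> + 1 / (p1 / (p1 - 1)))"
    and "0 \<le> w2" "w2 < 2 * real k - real CARD('n)"
    and "m < - real CARD('n) / r - w2 - 2 * real k * \<delta>"
    and "1 \<le> p2" "1 \<le> q2"
  shows "r_nuclear r (besov_space w1 (ereal p1) (ereal q1)) (besov_norm w1 (ereal p1) (ereal q1))
           (besov_space w2 p2 q2) (besov_norm w2 p2 q2) (\<lambda>u. fourier (pdo a u))"
proof -
  let ?E = "besov_space w1 (ereal p1) (ereal q1) :: (int^'n \<Rightarrow> complex) set"
  let ?nE = "besov_norm w1 (ereal p1) (ereal q1) :: (int^'n \<Rightarrow> complex) \<Rightarrow> real"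
  let ?F = "besov_space w2 p2 q2 :: (int^'n \<Rightarrow> complex) set"
  let ?nF = "besov_norm w2 p2 q2 :: (int^'n \<Rightarrow> complex) \<Rightarrow> real"
  let ?n = "real CARD('n)"
  \<comment> \<open>The growth exponent of derivatives of order \<open>2 * k\<close>; because
    \<open>\<delta> \<ge> 0\<close> it also dominates the exponent \<open>m\<close> of the symbol
    itself.\<close>
  define \<mu> where "\<mu> = m + 2 * real k * \<delta>"
  \<comment> \<open>The reciprocal of the conjugate exponent is at most 1/2 for
    \<open>p1 \<le> 2\<close>; together with \<open>\<alpha> \<le> 1/2\<close> this gives
    \<open>q1 \<ge> 1\<close>.\<close>
  have "0 \<le> 1 / (p1 / (p1 - 1))" "1 / (p1 / (p1 - 1)) \<le> 1 / 2"
    using \<open>1 < p1\<close> \<open>p1 \<le> 2\<close> by (auto simp: field_simps)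
  then have "0 < \<alpha> + 1 / (p1 / (p1 - 1))" "\<alpha> + 1 / (p1 / (p1 - 1)) \<le> 1"
    using assms by linarith+
  then have q1: "1 \<le> q1" unfolding assms(14) by (simp add: le_divide_eq)
  have w1: "0 \<le> w1" using assms by simp
  have p1': "1 \<le> ereal p1" and q1': "1 \<le> ereal q1" using \<open>1 < p1\<close> q1 by simp_all
  have jbr_pos: "0 < jbr \<xi>" for \<xi> :: "int^'n" using jbr_ge_1[of \<xi>] by linarith

  obtain \<phi> :: "nat \<Rightarrow> int^'n" where \<phi>: "bij \<phi>" using ex_enumeration_vec by blast
  define c where "c j u = u (\<phi> j)" for j and u :: "int^'n \<Rightarrow> complex"
  \<comment> \<open>By the modulation rule these are the coefficients of \<open>a\<close> at
    frequency \<open>\<phi> j\<close> times the character of that frequency.\<close>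
  define y where "y j \<eta> = fourier (\<lambda>x. a x (\<phi> j)) (\<eta> - \<phi> j)" for j \<eta>

  have diff: "\<And>is x \<xi>. pdl is (\<lambda>y. a y \<xi>) differentiable (at x)"
    and per: "\<And>x i \<xi>. a (x + axis i 1) \<xi> = a x \<xi>"
    using assms(10) by (auto simp: symbol_class_def)
  have cont: "continuous_on UNIV (\<lambda>x. a x \<xi>)" for \<xi>
    using diff[of "[]"] by (simp add: differentiable_imp_continuous_on differentiable_on_def)
  obtain A where A: "\<And>is x \<xi>. length is \<le> 2 * k \<Longrightarrow>
      cmod (pdl is (\<lambda>y. a y \<xi>) x) \<le> A is * jbr \<xi> powr (m + \<delta> * real (length is))"
  proof -
    have "\<forall>is. \<exists>C. length is \<le> 2 * k \<longrightarrow>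
        (\<forall>x \<xi>. cmod (pdl is (\<lambda>y. a y \<xi>) x) \<le> C * jbr \<xi> powr (m + \<delta> * real (length is)))"
      using assms(10) by (auto simp: symbol_class_def)
    from choice[OF this] show ?thesis using that by blast
  qed
  \<comment> \<open>One constant for the symbol and for its pure derivatives of order
    \<open>2 * k\<close> in all directions.\<close>
  define B where "B = \<bar>A []\<bar> + (\<Sum>i\<in>UNIV. \<bar>A (replicate (2 * k) i)\<bar>)"
  have B0: "0 \<le> B" by (simp add: B_def sum_nonneg)
  have bound0: "cmod (a x \<xi>) \<le> B * jbr \<xi> powr \<mu>" for x \<xi>
  proof -
    have "cmod (a x \<xi>) \<le> A [] * jbr \<xi> powr m" using A[of "[]" \<xi> x] by simp
    also have "\<dots> \<le> B * jbr \<xi> powr \<mu>"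
      using assms B0 jbr_ge_1[of \<xi>]
      by (intro mult_mono powr_mono) (auto simp: B_def \<mu>_def intro: order.trans[OF abs_ge_self] add_increasing2 sum_nonneg)
    finally show ?thesis .
  qed
  have bound: "cmod (pdl (replicate (2 * k) i) (\<lambda>y. a y \<xi>) x) \<le> B * jbr \<xi> powr \<mu>" for i x \<xi>
  proof -
    have "cmod (pdl (replicate (2 * k) i) (\<lambda>y. a y \<xi>) x) \<le> A (replicate (2 * k) i) * jbr \<xi> powr \<mu>"
      using A[of "replicate (2 * k) i" \<xi> x] by (simp add: \<mu>_def mult_ac)
    also have "A (replicate (2 * k) i) \<le> B"
      using member_le_sum[of i UNIV "\<lambda>i. \<bar>A (replicate (2 * k) i)\<bar>"] by (simp add: B_def)
    finally show ?thesis by (simp add: mult_right_mono)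
  qed
  have decay: "jbr \<zeta> powr (2 * real k) * cmod (fourier (\<lambda>x. a x \<xi>) \<zeta>)
      \<le> (1 + ?n) ^ (k + 1) * (B * jbr \<xi> powr \<mu>)" for \<xi> \<zeta>
    using fourier_decay[OF diff per bound0 bound, of \<zeta> \<xi>] jbr_pos[of \<zeta>]
    by (simp flip: powr_realpow)

  \<comment> \<open>\<open>D\<close> collects the factors independent of the frequency from the
    decay estimate and the shifted sum. The decay contributes the exponent \<open>\<mu>\<close> and
    the shift \<open>w2\<close>, which add up in \<open>K\<close>.\<close>
  define D where "D = 2 powr w2 * ((1 + ?n) ^ (k + 1) * B) * (\<Sum>\<^sub>\<infinity>\<zeta>::int^'n. jbr \<zeta> powr (w2 - 2 * real k))"
  define K where "K j = D * jbr (\<phi> j) powr (\<mu> + w2)" for j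
  have D0: "0 \<le> D" unfolding D_def using B0 by (intro mult_nonneg_nonneg infsum_nonneg) auto
  have K0: "0 \<le> K j" for j using D0 by (simp add: K_def)
  have y: "(\<Sum>\<eta>\<in>H. jbr \<eta> powr w2 * cmod (y j \<eta>)) \<le> K j" if "finite H" for H j
    using weighted_sum_shift_le[OF decay, of w2 H "\<phi> j" "\<phi> j"] assms that
    by (simp add: K_def D_def y_def powr_add mult_ac)

  \<comment> \<open>Since \<open>r \<le> 1\<close>, the assumption on \<open>m\<close> makes
    \<open>K\<close> itself summable, which drives the convergence of the expansion; nuclearity uses
    its \<open>r\<close>-th power.\<close>
  have "?n / r \<ge> ?n" using \<open>0 < r\<close> \<open>r \<le> 1\<close> by (simp add: le_divide_eq mult_left_le)
  then have \<mu>w: "\<mu> + w2 < - ?n" and \<mu>: "\<mu> < - ?n" using assms by (simp_all add: \<mu>_def)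
  have summ_a: "summable (\<lambda>j. B * jbr (\<phi> j) powr \<mu>)"
    by (intro summable_mult summable_jbr_powr_enumeration \<phi> \<mu>)
  have summ_K: "summable K"
    unfolding K_def by (intro summable_mult summable_jbr_powr_enumeration \<phi> \<mu>w)
  have summ_Kr: "summable (\<lambda>j. K j powr r)"
  proof -
    have "r * (\<mu> + w2) < - ?n"
      using assms(17) \<open>0 < r\<close> by (simp add: \<mu>_def field_simps)
    then have "summable (\<lambda>j. D powr r * jbr (\<phi> j) powr (r * (\<mu> + w2)))"
      by (intro summable_mult summable_jbr_powr_enumeration \<phi>)
    then show ?thesis using D0 by (simp add: K_def powr_mult powr_powr mult_ac)
  qed

  have coeff: "cmod (c j u) \<le> ?nE u" if "u \<in> ?E" for j u
    unfolding c_def using norm_coeff_le_besov_norm[OF that w1 \<open>1 < p1\<close>] q1 by simp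
  have sums: "(\<lambda>j. c j u * y j \<eta>) sums fourier (pdo a u) \<eta>" if "u \<in> ?E" for u \<eta>
    unfolding c_def y_def
    by (rule sums_fourier_pdo[OF \<phi> cont bound0 norm_coeff_le_besov_norm[OF that w1 \<open>1 < p1\<close>] summ_a])
      (use q1 in simp)
  have summ_u: "summable (\<lambda>j. cmod (c j u) * K j)" if "u \<in> ?E" for u
    by (rule summable_comparison_test'[OF summable_mult[OF summ_K, of "?nE u"], of 0])
      (use coeff[OF that] K0 in \<open>simp add: mult_right_mono\<close>)
  have tail: "(\<Sum>\<eta>\<in>H. jbr \<eta> powr w2 * cmod (fourier (pdo a u) \<eta> - (\<Sum>j<N. c j u * y j \<eta>)))
      \<le> (\<Sum>j. cmod (c (j + N) u) * K (j + N))" if "u \<in> ?E" "finite H" for u H N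
    by (rule weighted_sum_tail_le[OF sums[OF that(1)] _ y[OF that(2)] summ_u[OF that(1)] that(2)]) simp

  \<comment> \<open>The zero sequence makes the unit ball nonempty, so the supremum in
    \<open>dual_norm\<close> is a genuine one.\<close>
  have zero: "(\<lambda>_. 0) \<in> ?E" "?nE (\<lambda>_. 0) \<le> 1"
    using in_besov_space[of w1 "\<lambda>_. 0" 1, OF _ w1 p1' q1'] besov_norm_le[of w1 "\<lambda>_. 0" 1, OF _ w1 p1' q1']
    by simp_all
  have dual: "0 \<le> dual_norm ?E ?nE (c j)" "dual_norm ?E ?nE (c j) \<le> 1" for j
  proof -
    have le: "cmod (c j u) \<le> 1" if "u \<in> {u \<in> ?E. ?nE u \<le> 1}" for u
      using that coeff[of u j] by simp
    show "dual_norm ?E ?nE (c j) \<le> 1"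
      unfolding dual_norm_def by (rule cSUP_least) (use zero le in auto)
    have "cmod (c j (\<lambda>_. 0)) \<le> dual_norm ?E ?nE (c j)"
      unfolding dual_norm_def
      by (rule cSUP_upper) (use zero in \<open>auto intro: bdd_aboveI2[where M = 1, OF le]\<close>)
    then show "0 \<le> dual_norm ?E ?nE (c j)" by (rule order.trans[OF norm_ge_zero])
  qed
  note w2pq = \<open>0 \<le> w2\<close> \<open>1 \<le> p2\<close> \<open>1 \<le> q2\<close>

  show ?thesis
    unfolding r_nuclear_def
  proof (intro conjI exI[of _ c] exI[of _ y] ballI allI)
    fix u assume u: "u \<in> ?E"
    \<comment> \<open>For \<open>N = 0\<close> nothing is subtracted, and the tail bound becomes the
      weighted bound for the whole image.\<close>
    show "fourier (pdo a u) \<in> ?F"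
      using tail[OF u, of _ 0] by (intro in_besov_space[OF _ w2pq]) simp
    \<comment> \<open>The target norm of the remainder lies between 0 and the tail of a convergent
      series.\<close>
    have "(\<lambda>N. \<Sum>j. cmod (c (j + N) u) * K (j + N)) \<longlonglongrightarrow> 0"
      by (rule suminf_exist_split2[OF summ_u[OF u]])
    then show "(\<lambda>N. ?nF (\<lambda>\<xi>. fourier (pdo a u) \<xi> - (\<Sum>j<N. c j u * y j \<xi>))) \<longlonglongrightarrow> 0"
      by (rule tendsto_sandwich[OF _ _ tendsto_const, rotated 2])
        (use besov_norm_nonneg[OF tail[OF u] w2pq] besov_norm_le[OF tail[OF u] w2pq] in auto)
  next
    fix j
    show "bounded_functional ?E ?nE (c j)"
      unfolding bounded_functional_def
      using coeff by (auto simp: c_def intro!: exI[of _ 1])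
    show "y j \<in> ?F" by (rule in_besov_space[OF y w2pq])
  next
    show "summable (\<lambda>j. (dual_norm ?E ?nE (c j) * ?nF (y j)) powr r)"
    proof (rule summable_comparison_test'[OF summ_Kr, of 0])
      fix j
      have "dual_norm ?E ?nE (c j) * ?nF (y j) \<le> 1 * K j"
        by (intro mult_mono dual besov_norm_le[OF y w2pq] besov_norm_nonneg[OF y w2pq]) auto
      moreover have "0 \<le> dual_norm ?E ?nE (c j) * ?nF (y j)"
        by (intro mult_nonneg_nonneg dual besov_norm_nonneg[OF y w2pq])
      ultimately show "norm ((dual_norm ?E ?nE (c j) * ?nF (y j)) powr r) \<le> K j powr r"
        using \<open>0 < r\<close> by (simp add: powr_mono2)
    qed
  qed
qed

end
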